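(* For $L=1,2,\ldots$ let $$B_L:=(1-t_{L,L})\left(\int_{t_{L,L}}^1P_L(t)^2\,dt\right)^{-1}.$$ Then $$\lim_{L\to\infty}B_L=J_1(j_{0,1})^{-2}\approx 3.71038068570948.$$
   Context: $P_L$ is the Legendre polynomial of degree $L$, normalized by $P_L(1)=1$, and $t_{L,L}$ is its largest zero. $J_0,J_1$ are the Bessel functions of the first kind of orders $0$ and $1$, and $j_{0,1}$ is the smallest positive zero of $J_0$. *)

theory Defs
  imports "HOL-Analysis.Analysis" "HOL-Computational_Algebra.Polynomial"
begin

(* Rodrigues' formula P_n(x) = 1/(2^n n!) (d/dx)^n (x^2 - 1)^n. *)
definition legendre :: "nat \<Rightarrow> real poly" where
  "legendre n = smult (1 / (2 ^ n * fact n)) ((pderiv ^^ n) ([:-1, 0, 1:] ^ n))"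

lemma degree_legendre: "degree (legendre n) = n"
  by (simp add: legendre_def degree_higher_pderiv degree_power_eq)

lemma legendre_at_1: "poly (legendre n) 1 = 1"
proof -
  have shift: "pcompose ((pderiv ^^ k) p) [:1, 1:] = (pderiv ^^ k) (pcompose p [:1, 1:])"
    for k and p :: "real poly"
  proof (induction k)
    case (Suc k)
    have "pderiv (pcompose ((pderiv ^^ k) p) [:1, 1:]) = pcompose ((pderiv ^^ Suc k) p) [:1, 1:]"
      by (simp add: pderiv_pcompose pderiv_pCons)
    then show ?case
      by (simp add: Suc.IH)
  qed simp
  have pow: "pcompose (p ^ k) q = pcompose p q ^ k" for k and p q :: "real poly"
    by (induction k) (simp_all add: pcompose_mult pcompose_1)
  have fac: "[:0, 2, 1:] = monom 1 1 * ([:2, 1:] :: real poly)"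
    by (simp add: monom_altdef)
  have "poly ((pderiv ^^ n) ([:-1, 0, 1:] ^ n)) (1 :: real)
      = coeff (pcompose ((pderiv ^^ n) ([:-1, 0, 1:] ^ n)) [:1, 1:]) 0"
    by (simp add: poly_pcompose flip: poly_0_coeff_0)
  also have "\<dots> = coeff ((pderiv ^^ n) ([:0, 2, 1:] ^ n)) 0"
    by (simp add: shift pow pcompose_pCons)
  also have "\<dots> = fact n * coeff ([:0, 2, 1:] ^ n) n"
    by (simp add: coeff_higher_pderiv pochhammer_fact)
  also have "coeff ([:0, 2, 1:] ^ n) n = (2 :: real) ^ n"
    by (simp only: fac power_mult_distrib monom_power)
       (simp add: coeff_monom_mult flip: poly_0_coeff_0)
  finally show ?thesis
    by (simp add: legendre_def)
qed

definition legendre_largest_zero :: "nat \<Rightarrow> real" where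
  "legendre_largest_zero L = Max {x. poly (legendre L) x = 0}"

definition bessel_J :: "nat \<Rightarrow> real \<Rightarrow> real" where
  "bessel_J n x = (\<Sum>k. (-1) ^ k / (fact k * fact (k + n)) * (x / 2) ^ (2 * k + n))"

lemma summable_bessel_J:
  "summable (\<lambda>k. (-1) ^ k / (fact k * fact (k + n)) * (x / 2 :: real) ^ (2 * k + n))"
proof -
  define y where "y = x / 2"
  have "norm ((-1) ^ k / (fact k * fact (k + n)) * y ^ (2 * k + n))
      \<le> \<bar>y\<bar> ^ n * ((y\<^sup>2) ^ k /\<^sub>R fact k)" for k
  proof -
    have "1 / (fact k * fact (k + n)) \<le> (1 / fact k :: real)"
      using fact_ge_1[of "k + n", where 'a = real] by (simp add: field_simps)
    then have le: "1 / (fact k * fact (k + n)) * \<bar>y\<bar> ^ (2 * k + n)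
        \<le> 1 / fact k * \<bar>y\<bar> ^ (2 * k + n)"
      by (rule mult_right_mono) simp
    have pow: "\<bar>y\<bar> ^ (2 * k + n) = (y\<^sup>2) ^ k * \<bar>y\<bar> ^ n"
      by (simp add: power_add power_mult)
    from le have "1 / (fact k * fact (k + n)) * \<bar>y\<bar> ^ (2 * k + n)
        \<le> \<bar>y\<bar> ^ n * ((y\<^sup>2) ^ k /\<^sub>R fact k)"
      by (simp only: pow) (simp add: divide_inverse mult_ac)
    moreover have "norm ((-1) ^ k / (fact k * fact (k + n)) * y ^ (2 * k + n))
        = 1 / (fact k * fact (k + n)) * \<bar>y\<bar> ^ (2 * k + n)"
      by (simp only: real_norm_def abs_mult abs_divide power_abs) simp
    ultimately show ?thesis
      by simp
  qed
  then have "summable (\<lambda>k. (-1) ^ k / (fact k * fact (k + n)) * y ^ (2 * k + n))"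
    by (rule summable_comparison_test'[OF summable_mult[OF summable_exp_generic]])
  then show ?thesis
    by (simp only: y_def)
qed

definition bessel_j01 :: real where
  "bessel_j01 = (LEAST x. 0 < x \<and> bessel_J 0 x = 0)"

definition B :: "nat \<Rightarrow> real" where
  "B L = (1 - legendre_largest_zero L) *
     inverse (integral {legendre_largest_zero L..1} (\<lambda>t. (poly (legendre L) t)\<^sup>2))"

end

theory Submission
  imports Defs
begin

text \<open>
  Near the endpoint \<open>1\<close> the Legendre polynomials look like a Bessel function: with
  \<open>\<lambda> = L (L + 1)\<close>, the Taylor expansion of \<open>P\<^sub>L\<close> at \<open>1\<close> reads
  \<open>P\<^sub>L (1 - 2 s / \<lambda>) = (\<Sum>k. (\<Prod>i<k. 1 - i (i + 1) / \<lambda>) (-s)\<^sup>k / (k!)\<^sup>2)\<close>.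
  The product lies between \<open>0\<close> and \<open>1\<close> and tends to \<open>1\<close>, so by dominated convergence of series the
  right-hand side tends to \<open>C\<^sub>0 s = (\<Sum>k. (-s)\<^sup>k / (k!)\<^sup>2)\<close>, and does so along every bounded sequence of
  arguments (\<open>rescaled_legendre_tendsto\<close>). Here \<open>C\<^sub>m\<close> is the Bessel-Clifford function, for which
  \<open>J\<^sub>m x = (x / 2)\<^sup>m C\<^sub>m (x\<^sup>2 / 4)\<close>; it is an entire function of \<open>s\<close> and satisfies \<open>C\<^sub>m' = - C\<^sub>m\<^sub>+\<^sub>1\<close>, which
  makes it easier to handle than \<open>J\<^sub>m\<close> itself.

  Consequently the smallest positive zero \<open>s\<^sub>L = \<lambda> (1 - t\<^sub>L\<^sub>,\<^sub>L) / 2\<close> of the rescaled polynomial tends to the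
  smallest positive zero \<open>s\<^sub>* = j\<^sub>0\<^sub>,\<^sub>1\<^sup>2 / 4\<close> of \<open>C\<^sub>0\<close>: the latter is simple, so \<open>C\<^sub>0\<close> being small at \<open>s\<^sub>L\<close> forces
  \<open>s\<^sub>L\<close> to be close to \<open>s\<^sub>*\<close> (\<open>rescaled_zero_tendsto\<close>).

  The substitution \<open>t = 1 - (1 - t\<^sub>L\<^sub>,\<^sub>L) v\<close> absorbs the factor \<open>1 - t\<^sub>L\<^sub>,\<^sub>L\<close> and turns \<open>B L\<close> into the inverse of
  the integral over \<open>v \<in> [0, 1]\<close> of the squared rescaled polynomial at \<open>s\<^sub>L v\<close>, which converges to the
  integral of \<open>C\<^sub>0 (s\<^sub>* v)\<^sup>2\<close>. Since \<open>s C\<^sub>0\<^sup>2 + s\<^sup>2 C\<^sub>1\<^sup>2\<close> is an antiderivative of \<open>C\<^sub>0\<^sup>2\<close>, that integral is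
  \<open>s\<^sub>* C\<^sub>1 (s\<^sub>*)\<^sup>2 = J\<^sub>1 (j\<^sub>0\<^sub>,\<^sub>1)\<^sup>2\<close>.

  For the decimal value, \<open>s\<^sub>*\<close> is enclosed between two rationals at distance below \<open>10\<^sup>-\<^sup>1\<^sup>6\<close>. The signs of
  \<open>C\<^sub>0\<close> and the size of \<open>C\<^sub>1\<close> there follow from partial sums of alternating series, evaluated by Horner's
  scheme with directed rounding in the integers (\<open>bessel_clifford_zero_bracket\<close>).
\<close>

section \<open>Bessel-Clifford functions\<close>

definition bessel_clifford :: "nat \<Rightarrow> real \<Rightarrow> real" where
  "bessel_clifford m s = (\<Sum>k. (-1) ^ k / (fact k * fact (k + m)) * s ^ k)"

lemma bessel_clifford_term_le:
  "\<bar>(-1) ^ k / (fact k * fact (k + m)) * s ^ k\<bar> \<le> \<bar>s\<bar> ^ k / (fact k :: real)"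
proof -
  have "1 * \<bar>s\<bar> ^ k \<le> fact (k + m) * \<bar>s\<bar> ^ k"
    by (intro mult_right_mono fact_ge_1) auto
  then show ?thesis
    by (simp add: abs_mult abs_divide power_abs field_simps)
qed

lemma summable_power_divide_fact: "summable (\<lambda>k. x ^ k / (fact k :: real))"
  using summable_exp[of x] by (simp add: field_simps)

lemma summable_bessel_clifford:
  "summable (\<lambda>k. (-1) ^ k / (fact k * fact (k + m)) * s ^ k :: real)"
  by (rule summable_comparison_test'[OF summable_power_divide_fact[of "\<bar>s\<bar>"]])
     (use bessel_clifford_term_le in auto)

lemma bessel_J_eq_bessel_clifford:
  "bessel_J m x = (x / 2) ^ m * bessel_clifford m ((x / 2)\<^sup>2)"
  unfolding bessel_J_def bessel_clifford_def
  by (subst suminf_mult[OF summable_bessel_clifford, symmetric])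
     (simp add: power_add mult_ac flip: power_mult)

lemma bessel_clifford_deriv:
  "(bessel_clifford m has_real_derivative - bessel_clifford (Suc m) s) (at s)"
proof -
  define c :: "nat \<Rightarrow> real" where "c = (\<lambda>k. (-1) ^ k / (fact k * fact (k + m)))"
  have d: "diffs c k = - ((-1) ^ k / (fact k * fact (k + Suc m)))" for k
  proof -
    have "(fact (Suc k) :: real) = real (Suc k) * fact k" by simp
    then show ?thesis
      unfolding diffs_def c_def by (simp del: fact_Suc of_nat_Suc)
  qed
  have "((\<lambda>x. \<Sum>k. c k * x ^ k) has_real_derivative (\<Sum>k. diffs c k * s ^ k)) (at s)"
    by (rule termdiffs_strong_converges_everywhere)
       (use summable_bessel_clifford in \<open>simp only: c_def\<close>)
  moreover have "(\<Sum>k. diffs c k * s ^ k) = - bessel_clifford (Suc m) s"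
    using suminf_minus[OF summable_bessel_clifford[of "Suc m" s]]
    by (simp add: d bessel_clifford_def)
  moreover have "(\<lambda>x. \<Sum>k. c k * x ^ k) = bessel_clifford m"
    by (simp add: fun_eq_iff c_def bessel_clifford_def)
  ultimately show ?thesis by simp
qed

lemma continuous_on_bessel_clifford: "continuous_on S (bessel_clifford m)"
  using bessel_clifford_deriv by (meson DERIV_continuous continuous_at_imp_continuous_on)

text \<open>
  This is Bessel's equation \<open>s y'' + y' + y = 0\<close> for \<open>y = C\<^sub>0\<close>, whose derivatives are \<open>- C\<^sub>1\<close> and \<open>C\<^sub>2\<close>.
\<close>
lemma bessel_clifford_rec:
  "bessel_clifford 0 s = bessel_clifford 1 s - s * bessel_clifford 2 s"
proof -
  define A where "A = (\<lambda>m k. (-1) ^ k / (fact k * fact (k + m)) * s ^ k)"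
  have sA: "summable (A m)" for m
    using summable_bessel_clifford[of m s] by (simp add: A_def)
  have step: "A 0 (Suc k) - A 1 (Suc k) = - (s * A 2 k)" for k
  proof -
    define F where "F = (fact k :: real)"
    have f: "fact k = F" "fact (Suc k) = (k + 1) * F" "fact (k + 2) = (k + 2) * ((k + 1) * F)"
      "fact (Suc k + 1) = (k + 2) * ((k + 1) * F)"
      by (simp_all add: F_def numeral_2_eq_2 algebra_simps)
    have "F \<noteq> 0" "real k + 1 \<noteq> 0" "real k + 2 \<noteq> 0"
      by (simp_all add: F_def add_eq_0_iff)
    then show ?thesis
      unfolding A_def add_0_right f power_Suc
      by (simp add: divide_simps) (simp add: algebra_simps)
  qed
  have "suminf (A 0) - suminf (A 1) = (\<Sum>k. A 0 k - A 1 k)"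
    by (rule suminf_diff[OF sA sA])
  also have "\<dots> = (A 0 0 - A 1 0) + (\<Sum>k. A 0 (Suc k) - A 1 (Suc k))"
    using suminf_split_head[OF summable_diff[OF sA[of 0] sA[of 1]]] by simp
  also have "\<dots> = - (s * suminf (A 2))"
    using suminf_minus[OF summable_mult[OF sA[of 2], of s]] suminf_mult[OF sA[of 2], of s]
    unfolding step by (simp add: A_def)
  finally show ?thesis
    by (simp add: bessel_clifford_def A_def)
qed

text \<open>
  The ratio of consecutive terms is \<open>s / ((k + 1) (k + 1 + m))\<close>, which is largest for \<open>k = 0\<close>; up to
  \<open>s = 1 + m\<close> the alternating series therefore decreases from its first term on.
\<close>
lemma bessel_clifford_Leibniz:
  assumes "0 \<le> s" "s \<le> 1 + real m"
  shows "(\<Sum>k<2*n. (-1) ^ k * (s ^ k / (fact k * fact (k + m)))) \<le> bessel_clifford m s"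
    and "bessel_clifford m s \<le> (\<Sum>k<2*n+1. (-1) ^ k * (s ^ k / (fact k * fact (k + m))))"
proof -
  define a where "a = (\<lambda>k. s ^ k / (fact k * fact (k + m)))"
  have "summable a"
    by (rule summable_comparison_test'[OF summable_power_divide_fact[of "\<bar>s\<bar>"]])
       (use bessel_clifford_term_le[of _ m s] in \<open>simp add: a_def abs_mult\<close>)
  then have lim: "a \<longlonglongrightarrow> 0" by (rule summable_LIMSEQ_zero)
  have nonneg: "0 \<le> a k" for k using assms by (simp add: a_def)
  have mono: "a (Suc k) \<le> a k" for k
  proof -
    have "s \<le> (1 + real k) * (1 + real (k + m))"
      using assms by (simp add: algebra_simps) (smt (verit) mult_nonneg_nonneg of_nat_0_le_iff)
    then have q: "s / ((1 + real k) * (1 + real (k + m))) \<le> 1"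
      by (simp add: divide_le_eq)
    have "a (Suc k) = a k * (s / ((1 + real k) * (1 + real (k + m))))"
      by (simp add: a_def mult_ac)
    also have "\<dots> \<le> a k * 1"
      by (rule mult_left_mono[OF q nonneg])
    finally show ?thesis by simp
  qed
  have eq: "bessel_clifford m s = (\<Sum>k. (-1) ^ k * a k)"
    by (simp add: bessel_clifford_def a_def)
  show "(\<Sum>k<2*n. (-1) ^ k * (s ^ k / (fact k * fact (k + m)))) \<le> bessel_clifford m s"
    using summable_Leibniz'(2)[OF lim nonneg mono, of n] by (simp add: eq a_def)
  show "bessel_clifford m s \<le> (\<Sum>k<2*n+1. (-1) ^ k * (s ^ k / (fact k * fact (k + m))))"
    using summable_Leibniz'(4)[OF lim nonneg mono, of n] by (simp add: eq a_def)
qed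

lemma bessel_clifford_pos:
  assumes "0 \<le> s" "s < 1 + real m"
  shows "1 - s / (1 + real m) \<le> fact m * bessel_clifford m s" "0 < bessel_clifford m s"
proof -
  have "1 / fact m - s / ((1 + real m) * fact m) \<le> bessel_clifford m s"
    using bessel_clifford_Leibniz(1)[of s m 1] assms by (simp add: numeral_2_eq_2)
  then have "fact m * (1 / fact m - s / ((1 + real m) * fact m)) \<le> fact m * bessel_clifford m s"
    by (rule mult_left_mono) simp
  moreover have "fact m * (1 / fact m - s / ((1 + real m) * fact m)) = 1 - s / (1 + real m)"
    by (simp add: right_diff_distrib)
  ultimately show *: "1 - s / (1 + real m) \<le> fact m * bessel_clifford m s" by simp
  have "0 < 1 - s / (1 + real m)" using assms by (simp add: field_simps)
  with * have "0 < fact m * bessel_clifford m s" by linarith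
  then show "0 < bessel_clifford m s" by (simp add: zero_less_mult_iff)
qed

text \<open>
  The derivative \<open>- C\<^sub>m\<^sub>+\<^sub>1\<close> is negative as long as the Leibniz bound of index \<open>m + 1\<close> applies. For \<open>m = 0\<close>
  this covers \<open>[0, 2)\<close>, which contains the first zero of \<open>C\<^sub>0\<close> and makes it unique there.
\<close>
lemma bessel_clifford_strict_antimono:
  assumes "0 \<le> x" "x < y" "y < 2 + real m"
  shows "bessel_clifford m y < bessel_clifford m x"
  by (rule DERIV_neg_imp_decreasing[OF assms(2)])
     (use bessel_clifford_deriv[of m] bessel_clifford_pos(2)[of _ "Suc m"] assms in \<open>force\<close>)

section \<open>Rational enclosures of Bessel-Clifford values\<close>

text \<open>
  Horner's scheme for the first \<open>n\<close> terms of \<open>m! C\<^sub>m (p / q)\<close>, scaled by \<open>T\<close>: the terms from index \<open>k\<close> on,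
  divided by the factors that they share, satisfy \<open>h\<^sub>n\<^sub>+\<^sub>1\<^sub>,\<^sub>k = 1 - p / (q (k + 1) (k + 1 + m)) h\<^sub>n\<^sub>,\<^sub>k\<^sub>+\<^sub>1\<close>.
  Each level reverses inequalities, just as partial sums of even and odd length lie on opposite sides
  of the limit, so the rounding direction alternates with \<open>n\<close>; the sign \<open>(-1)\<^sup>n\<close> inside and outside
  \<open>div\<close> switches between floor and ceiling. All results have about as many digits as \<open>T\<close>.
\<close>
primrec rounded_horner :: "int \<Rightarrow> int \<Rightarrow> int \<Rightarrow> nat \<Rightarrow> nat \<Rightarrow> nat \<Rightarrow> int" where
  "rounded_horner T p q m 0 k = 0"
| "rounded_horner T p q m (Suc n) k =
     T - (-1) ^ n * (((-1) ^ n * (p * rounded_horner T p q m n (Suc k))) div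
                      (q * (int (Suc k) * int (Suc k + m))))"

text \<open>
  The exact scheme \<open>h\<close> is antitone in its inner value because \<open>p / q\<close> is nonnegative. An even partial
  sum, wanted as a lower bound of the limit, hence takes an upper bound of the odd sum inside it and
  is itself rounded down; for odd partial sums the roles are exchanged.
\<close>
lemma rounded_horner_bounds:
  fixes p q T :: int and m :: nat and h :: "nat \<Rightarrow> nat \<Rightarrow> real"
  assumes "0 \<le> p" "0 < q"
  defines "h \<equiv> \<lambda>n k. \<Sum>j<n. (-1) ^ j * (real_of_int p / real_of_int q) ^ j *
                          (fact k * fact (k + m) / (fact (k + j) * fact (k + j + m)))"
  shows "if even n then real_of_int (rounded_horner T p q m n k) \<le> T * h n k
         else T * h n k \<le> real_of_int (rounded_horner T p q m n k)"
proof (induction n arbitrary: k)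
  case 0
  show ?case by (simp add: h_def)
next
  case (Suc n)
  define D where "D = q * (int (Suc k) * int (Suc k + m))"
  define y where "y = p * rounded_horner T p q m n (Suc k)"
  have "0 < int (Suc k) * int (Suc k + m)" by (intro mult_pos_pos) auto
  then have D: "0 < D" using assms unfolding D_def by (intro mult_pos_pos) auto
  have step: "h (Suc n) k = 1 - p / D * h n (Suc k)"
  proof -
    have t: "(fact k * fact (k + m) / (fact (k + Suc j) * fact (k + Suc j + m)) :: real)
      = 1 / (real (Suc k) * real (Suc k + m)) *
        (fact (Suc k) * fact (Suc k + m) / (fact (Suc k + j) * fact (Suc k + j + m)))" for j
    proof -
      have "(fact (Suc k) :: real) = real (Suc k) * fact k"
           "(fact (Suc k + m) :: real) = real (Suc k + m) * fact (k + m)"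
        by simp_all
      then show ?thesis by (simp del: fact_Suc of_nat_Suc)
    qed
    have "h (Suc n) k = 1 + (\<Sum>j<n. (-1) ^ Suc j * (p / q) ^ Suc j *
         (fact k * fact (k + m) / (fact (k + Suc j) * fact (k + Suc j + m))))"
      unfolding h_def by (subst sum.lessThan_Suc_shift) simp
    also have "\<dots> = 1 + (\<Sum>j<n. - (p / D) * ((-1) ^ j * (p / q) ^ j *
         (fact (Suc k) * fact (Suc k + m) / (fact (Suc k + j) * fact (Suc k + j + m)))))"
      unfolding t by (simp add: D_def mult_ac del: fact_Suc of_nat_Suc)
    also have "\<dots> = 1 - p / D * h n (Suc k)"
      unfolding h_def sum_distrib_left[symmetric] by simp
    finally show ?thesis .
  qed
  have y: "real_of_int y / D = p / D * rounded_horner T p q m n (Suc k)"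
    by (simp add: y_def)
  have pD: "0 \<le> real_of_int p / D" using assms D by simp
  have Th: "T * h (Suc n) k = T - p / D * (T * h n (Suc k))"
    by (simp add: step algebra_simps)
  show ?case
  proof (cases "even n")
    case True
    then have "p / D * rounded_horner T p q m n (Suc k) \<le> p / D * (T * h n (Suc k))"
      using Suc.IH[of "Suc k"] pD by (intro mult_left_mono) auto
    then have "T * h (Suc n) k \<le> T - real_of_int (y div D)"
      using real_of_int_div4[of y D] unfolding Th y by linarith
    moreover have "rounded_horner T p q m (Suc n) k = T - y div D"
      using True unfolding rounded_horner.simps y_def[symmetric] D_def[symmetric] by simp
    ultimately show ?thesis using True by simp
  next
    case False
    then have "p / D * (T * h n (Suc k)) \<le> p / D * rounded_horner T p q m n (Suc k)"
      using Suc.IH[of "Suc k"] pD by (intro mult_left_mono) auto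
    then have "T + real_of_int (- y div D) \<le> T * h (Suc n) k"
      using real_of_int_div4[of "- y" D] y unfolding Th by simp
    moreover have "rounded_horner T p q m (Suc n) k = T + (- y div D)"
      using False unfolding rounded_horner.simps y_def[symmetric] D_def[symmetric] by simp
    ultimately show ?thesis using False by simp
  qed
qed

lemma bessel_clifford_horner_bounds:
  assumes "0 \<le> p" "0 < q" "p \<le> (1 + int m) * q" "0 < T"
  shows "rounded_horner T p q m (2 * n) 0 / (real_of_int T * fact m) \<le> bessel_clifford m (p / q)"
    and "bessel_clifford m (p / q)
           \<le> rounded_horner T p q m (2 * n + 1) 0 / (real_of_int T * fact m)"
proof -
  have "real_of_int p \<le> (1 + real m) * q"
    using of_int_le_iff[where 'a = real, THEN iffD2, OF assms(3)] by simp
  then have x: "0 \<le> real_of_int p / q" "real_of_int p / q \<le> 1 + real m" 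
    using assms by (simp_all add: divide_le_eq)
  note L = bessel_clifford_Leibniz[OF x, where n = n]
  have eq: "T * (\<Sum>j<i. (-1) ^ j * (real_of_int p / q) ^ j *
      (fact 0 * fact (0 + m) / (fact (0 + j) * fact (0 + j + m)))) =
     (\<Sum>j<i. (-1) ^ j * ((real_of_int p / q) ^ j / (fact j * fact (j + m))))
     * (real_of_int T * fact m)" for i
    by (simp add: sum_distrib_left sum_distrib_right mult_ac)
  have T: "0 < real_of_int T * fact m" using assms by simp
  show "rounded_horner T p q m (2 * n) 0 / (real_of_int T * fact m) \<le> bessel_clifford m (p / q)"
  proof -
    have "real_of_int (rounded_horner T p q m (2 * n) 0)
        \<le> (\<Sum>j<2 * n. (-1) ^ j * ((real_of_int p / q) ^ j / (fact j * fact (j + m))))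
          * (real_of_int T * fact m)"
      using rounded_horner_bounds[OF assms(1,2), of "2 * n" T m 0] unfolding eq by simp
    also have "\<dots> \<le> bessel_clifford m (p / q) * (real_of_int T * fact m)"
      by (rule mult_right_mono[OF L(1)]) (use T in simp)
    finally show ?thesis using T by (simp only: pos_divide_le_eq)
  qed
  show "bessel_clifford m (p / q) \<le> rounded_horner T p q m (2 * n + 1) 0 / (real_of_int T * fact m)"
  proof -
    have "bessel_clifford m (p / q) * (real_of_int T * fact m)
        \<le> (\<Sum>j<2 * n + 1. (-1) ^ j * ((real_of_int p / q) ^ j / (fact j * fact (j + m))))
          * (real_of_int T * fact m)"
      by (rule mult_right_mono[OF L(2)]) (use T in simp)
    also have "\<dots> \<le> real_of_int (rounded_horner T p q m (2 * n + 1) 0)"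
      using rounded_horner_bounds[OF assms(1,2), of "2 * n + 1" T m 0] unfolding eq by simp
    finally show ?thesis using T by (simp only: pos_le_divide_eq)
  qed
qed

text \<open>
  The two arguments are consecutive convergents of the continued fraction of the zero; they lie within
  \<open>4 * 10\<^sup>-\<^sup>1\<^sup>7\<close> of it while their numerators and denominators have only nine digits. The values of \<open>C\<^sub>0\<close>
  there are of the order \<open>10\<^sup>-\<^sup>1\<^sup>7\<close>, so \<open>14\<close> or \<open>15\<close> terms (error below \<open>10\<^sup>-\<^sup>2\<^sup>0\<close>) and \<open>20\<close> digits suffice. The
  recurrence reduces \<open>C\<^sub>0\<close> to \<open>C\<^sub>1\<close> and \<open>C\<^sub>2\<close>, whose terms decrease from the start; those of \<open>C\<^sub>0\<close> do not,
  as the argument exceeds \<open>1\<close>.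
\<close>
lemma bessel_clifford_zero_bracket:
  "0 < bessel_clifford 0 (176210870/121878059)" "bessel_clifford 0 (253352189/175233645) < 0"
  "bessel_clifford 1 (176210870/121878059) \<le> 0.4317548070196804"
  "0.4317548070196803 \<le> bessel_clifford 1 (253352189/175233645)"
proof -
  have eval: "rounded_horner T p q m (numeral w) k =
     T - (-1) ^ pred_numeral w *
         (((-1) ^ pred_numeral w * (p * rounded_horner T p q m (pred_numeral w) (Suc k))) div
          (q * (int (Suc k) * int (Suc k + m))))" for T p q m w k
    by (simp only: numeral_eq_Suc rounded_horner.simps)
  note a_bounds = bessel_clifford_horner_bounds[of 176210870 121878059 _ "10 ^ 20" 7]
  note b_bounds = bessel_clifford_horner_bounds[of 253352189 175233645 _ "10 ^ 20" 7]
  show "0 < bessel_clifford 0 (176210870/121878059)"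
    using a_bounds(1)[of 1] a_bounds(2)[of 2]
    unfolding bessel_clifford_rec by (simp add: eval)
  show "bessel_clifford 0 (253352189/175233645) < 0"
    using b_bounds(2)[of 1] b_bounds(1)[of 2]
    unfolding bessel_clifford_rec by (simp add: eval)
  show "bessel_clifford 1 (176210870/121878059) \<le> 0.4317548070196804"
    using a_bounds(2)[of 1] by (simp add: eval)
  show "0.4317548070196803 \<le> bessel_clifford 1 (253352189/175233645)"
    using b_bounds(1)[of 1] by (simp add: eval)
qed

section \<open>The first zero and the norm integral\<close>

lemma clifford_zero_ex:
  "\<exists>s. 176210870/121878059 < s \<and> s < 253352189/175233645 \<and> bessel_clifford 0 s = 0"
proof -
  have "\<exists>s. 176210870/121878059 \<le> s \<and> s \<le> 253352189/175233645 \<and> bessel_clifford 0 s = 0"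
    using bessel_clifford_zero_bracket(1,2)
    by (intro IVT2' continuous_on_bessel_clifford) auto
  then show ?thesis
    using bessel_clifford_zero_bracket(1,2) by (metis less_eq_real_def less_irrefl)
qed

text \<open>
  This is \<open>(j\<^sub>0\<^sub>,\<^sub>1 / 2)\<^sup>2\<close>, see \<open>bessel_j01_eq\<close>. Choosing it inside the enclosure makes the numerical
  information available from the start; it is also what shows that the least zero exists.
\<close>
definition clifford_zero :: real where
  "clifford_zero =
     (SOME s. 176210870/121878059 < s \<and> s < 253352189/175233645 \<and> bessel_clifford 0 s = 0)"

lemma clifford_zero:
  "176210870/121878059 < clifford_zero" "clifford_zero < 253352189/175233645"
  "bessel_clifford 0 clifford_zero = 0"
  using someI_ex[OF clifford_zero_ex] by (simp_all add: clifford_zero_def)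

lemma clifford_zero_pos: "0 < clifford_zero" and clifford_zero_less: "clifford_zero < 3 / 2"
  using clifford_zero(1,2) by simp_all

lemma bessel_j01_eq: "bessel_j01 = 2 * sqrt clifford_zero"
  unfolding bessel_j01_def
proof (rule Least_equality)
  show "0 < 2 * sqrt clifford_zero \<and> bessel_J 0 (2 * sqrt clifford_zero) = 0"
    using clifford_zero_pos by (simp add: bessel_J_eq_bessel_clifford clifford_zero)
next
  fix x assume x: "0 < x \<and> bessel_J 0 x = 0"
  show "2 * sqrt clifford_zero \<le> x"
  proof (rule ccontr)
    assume "\<not> 2 * sqrt clifford_zero \<le> x"
    then have "(x / 2)\<^sup>2 < (sqrt clifford_zero)\<^sup>2"
      using x by (intro power_strict_mono) auto
    then have "(x / 2)\<^sup>2 < clifford_zero"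
      using clifford_zero_pos by simp
    then have "bessel_clifford 0 clifford_zero < bessel_clifford 0 ((x / 2)\<^sup>2)"
      using clifford_zero_less by (intro bessel_clifford_strict_antimono) auto
    then show False
      using x by (simp add: bessel_J_eq_bessel_clifford clifford_zero)
  qed
qed

lemma bessel_J1_at_zero:
  "(bessel_J 1 bessel_j01)\<^sup>2 = clifford_zero * (bessel_clifford 1 clifford_zero)\<^sup>2"
  using clifford_zero_pos
  by (simp add: bessel_J_eq_bessel_clifford bessel_j01_eq power_mult_distrib)

text \<open>
  Both factors of \<open>s\<^sub>* C\<^sub>1 (s\<^sub>*)\<^sup>2\<close> are enclosed with relative error below \<open>3 * 10\<^sup>-\<^sup>1\<^sup>6\<close>. The inverse is about
  \<open>1.8 * 10\<^sup>-\<^sup>1\<^sup>5\<close> above the stated decimal, which leaves a margin of about \<open>3 * 10\<^sup>-\<^sup>1\<^sup>5\<close> for these errors.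
\<close>
lemma bessel_J1_at_zero_value:
  "\<bar>inverse ((bessel_J 1 bessel_j01)\<^sup>2) - 3.71038068570948\<bar> \<le> 5 / 10 ^ 15"
proof -
  define g where "g = bessel_clifford 1 clifford_zero"
  have "bessel_clifford 1 clifford_zero < bessel_clifford 1 (176210870/121878059)"
    "bessel_clifford 1 (253352189/175233645) < bessel_clifford 1 clifford_zero"
    using clifford_zero(1,2) clifford_zero_pos by (intro bessel_clifford_strict_antimono; simp)+
  then have g: "0.4317548070196803 \<le> g" "g \<le> 0.4317548070196804"
    using bessel_clifford_zero_bracket(3,4) by (simp_all add: g_def)
  have low: "176210870/121878059 * 0.4317548070196803\<^sup>2 \<le> clifford_zero * g\<^sup>2"
    using g clifford_zero(1) by (intro mult_mono power_mono) auto
  have high: "clifford_zero * g\<^sup>2 \<le> 253352189/175233645 * 0.4317548070196804\<^sup>2"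
    using g clifford_zero(2) by (intro mult_mono power_mono) auto
  have "inverse (clifford_zero * g\<^sup>2) \<le> inverse (176210870/121878059 * 0.4317548070196803\<^sup>2)"
    by (rule le_imp_inverse_le[OF low]) simp
  also have "\<dots> \<le> 3.71038068570948 + 5 / 10 ^ 15"
    by (simp add: power2_eq_square)
  finally have 1: "inverse (clifford_zero * g\<^sup>2) \<le> 3.71038068570948 + 5 / 10 ^ 15" .
  have "3.71038068570948 - 5 / 10 ^ 15 \<le> inverse (253352189/175233645 * 0.4317548070196804\<^sup>2 :: real)"
    by (simp add: power2_eq_square)
  also have "\<dots> \<le> inverse (clifford_zero * g\<^sup>2)"
    using g clifford_zero_pos by (intro le_imp_inverse_le[OF high] mult_pos_pos) auto
  finally have 2: "3.71038068570948 - 5 / 10 ^ 15 \<le> inverse (clifford_zero * g\<^sup>2)" .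
  show ?thesis
    unfolding bessel_J1_at_zero g_def[symmetric] using 1 2 by linarith
qed

text \<open>
  The antiderivative \<open>K = x C\<^sub>0\<^sup>2 + x\<^sup>2 C\<^sub>1\<^sup>2\<close> of \<open>C\<^sub>0\<^sup>2\<close> comes from Lommel's antiderivative
  \<open>r\<^sup>2 (J\<^sub>0\<^sup>2 + J\<^sub>1\<^sup>2) / 2\<close> of \<open>r J\<^sub>0\<^sup>2\<close> by the substitution \<open>x = r\<^sup>2 / 4\<close>, under which \<open>dx = r dr / 2\<close>.
\<close>
lemma integral_bessel_clifford_sq:
  assumes "0 < s" "bessel_clifford 0 s = 0"
  shows "((\<lambda>v. (bessel_clifford 0 (s * v))\<^sup>2) has_integral s * (bessel_clifford 1 s)\<^sup>2) {0..1}"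
proof -
  define K where "K = (\<lambda>x. x * (bessel_clifford 0 x)\<^sup>2 + x\<^sup>2 * (bessel_clifford 1 x)\<^sup>2)"
  have K: "(K has_real_derivative (bessel_clifford 0 x)\<^sup>2) (at x)" for x
  proof -
    have "(K has_real_derivative
        (bessel_clifford 0 x)\<^sup>2 - 2 * x * bessel_clifford 0 x * bessel_clifford 1 x
        + 2 * x * (bessel_clifford 1 x)\<^sup>2 - 2 * x * bessel_clifford 1 x * (x * bessel_clifford 2 x)) (at x)"
      unfolding K_def
      by (rule derivative_eq_intros bessel_clifford_deriv refl)+
         (simp add: numeral_2_eq_2 power2_eq_square algebra_simps)
    moreover have "x * bessel_clifford 2 x = bessel_clifford 1 x - bessel_clifford 0 x"
      using bessel_clifford_rec[of x] by simp
    ultimately show ?thesis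
      by (simp add: power2_eq_square algebra_simps)
  qed
  have "((\<lambda>v. K (s * v) / s) has_real_derivative (bessel_clifford 0 (s * v))\<^sup>2) (at v)" for v
    using \<open>0 < s\<close>
    by (auto intro!: derivative_eq_intros DERIV_chain2[OF K])
  then have "((\<lambda>v. (bessel_clifford 0 (s * v))\<^sup>2) has_integral K (s * 1) / s - K (s * 0) / s) {0..1}"
    by (intro fundamental_theorem_of_calculus)
       (auto simp: has_real_derivative_iff_has_vector_derivative[symmetric] has_field_derivative_at_within)
  then show ?thesis
    using assms by (simp add: K_def power2_eq_square)
qed

section \<open>Legendre polynomials near the endpoint\<close>

text \<open>
  Shifting Rodrigues' formula by \<open>1\<close> gives the \<open>n\<close>-th derivative of \<open>y\<^sup>n (y + 2)\<^sup>n\<close>, whose coefficients are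
  those of \<open>(y + 2)\<^sup>n\<close> times a rising factorial.
\<close>
lemma poly_legendre_around_1:
  "poly (legendre n) (1 + y) =
     (\<Sum>k\<le>n. fact (n + k) / (fact (n - k) * (fact k)\<^sup>2) * (y / 2) ^ k)"
proof -
  have shift: "pcompose ((pderiv ^^ k) p) [:1, 1:] = (pderiv ^^ k) (pcompose p [:1, 1:])"
    for k and p :: "real poly"
  proof (induction k)
    case (Suc k)
    have "pcompose ((pderiv ^^ Suc k) p) [:1, 1:] = pderiv (pcompose ((pderiv ^^ k) p) [:1, 1:])"
      by (simp add: pderiv_pcompose pderiv_pCons)
    then show ?case
      by (simp only: Suc.IH funpow.simps comp_apply)
  qed simp
  have pow: "pcompose (p ^ k) q = pcompose p q ^ k" for k and p q :: "real poly"
    by (induction k) (simp_all add: pcompose_mult pcompose_1)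
  have fac: "[:0, 2, 1:] = monom 1 1 * ([:2, 1:] :: real poly)"
    by (simp add: monom_altdef)
  define Q where "Q = pcompose (legendre n) [:1, 1:]"
  have Q: "Q = smult (1 / (2 ^ n * fact n)) ((pderiv ^^ n) (monom 1 n * [:2, 1:] ^ n))"
  proof -
    have "pcompose [:-1, 0, 1:] [:1, 1:] = [:0, 2, 1 :: real:]"
      by (simp add: pcompose_pCons)
    then have "pcompose ([:-1, 0, 1:] ^ n) [:1, 1:] = monom 1 n * ([:2, 1:] :: real poly) ^ n"
      by (simp only: pow fac power_mult_distrib monom_power) simp
    then show ?thesis
      by (simp add: Q_def legendre_def pcompose_smult shift)
  qed
  have coeff: "coeff Q k = fact (n + k) / (fact (n - k) * (fact k)\<^sup>2) / 2 ^ k" if "k \<le> n" for k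
  proof -
    have "coeff ([:2, 1:] ^ n :: real poly) k = real (n choose k) * 2 ^ (n - k)"
      by (subst coeff_linear_poly_power) (use that in auto)
    moreover have "pochhammer (real (Suc k)) n = fact (n + k) / fact k"
      using pochhammer_product'[of "1::real" k n]
      by (simp add: add.commute field_simps flip: pochhammer_fact)
    moreover have "(2::real) ^ n = 2 ^ (n - k) * 2 ^ k"
      using that by (simp flip: power_add)
    moreover have "real (n choose k) = fact n / (fact k * fact (n - k))"
      using that by (simp add: binomial_fact)
    ultimately show ?thesis
      by (simp add: Q coeff_higher_pderiv coeff_monom_mult power2_eq_square)
  qed
  have "degree Q = n"
    by (simp add: Q_def degree_legendre degree_pcompose)
  then have "poly Q y = (\<Sum>k\<le>n. coeff Q k * y ^ k)"
    by (simp add: poly_altdef)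
  also have "\<dots> = (\<Sum>k\<le>n. fact (n + k) / (fact (n - k) * (fact k)\<^sup>2) * (y / 2) ^ k)"
    by (intro sum.cong) (simp_all add: coeff power_divide)
  finally show ?thesis
    by (simp add: Q_def poly_pcompose)
qed

definition legendre_eigenvalue :: "nat \<Rightarrow> real" where
  "legendre_eigenvalue L = real (L * (L + 1))"

lemma legendre_eigenvalue_pos: "0 < L \<Longrightarrow> 0 < legendre_eigenvalue L"
  unfolding legendre_eigenvalue_def of_nat_0_less_iff by simp

text \<open>
  The \<open>k\<close>-th Taylor coefficient of \<open>P\<^sub>L (1 - 2 s / (L (L + 1)))\<close> in \<open>s\<close> divided by that of \<open>C\<^sub>0\<close>. In this
  product form both its bound and its limit are visible; for \<open>k > L\<close> the factor \<open>i = L\<close> makes it vanish.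
\<close>
definition coeff_ratio :: "nat \<Rightarrow> nat \<Rightarrow> real" where
  "coeff_ratio L k = (\<Prod>i<k. 1 - real (i * (i + 1)) / legendre_eigenvalue L)"

lemma coeff_ratio_zero:
  assumes "L < k" "0 < L"
  shows "coeff_ratio L k = 0"
  unfolding coeff_ratio_def
proof (rule prod_zero)
  show "\<exists>i\<in>{..<k}. 1 - real (i * (i + 1)) / legendre_eigenvalue L = 0"
    using assms legendre_eigenvalue_pos[of L]
    by (intro bexI[of _ L]) (simp_all add: legendre_eigenvalue_def)
qed simp

text \<open>
  For \<open>k \<le> L\<close> every factor lies in \<open>[0, 1]\<close>; negative factors occur only after the factor \<open>0\<close>. For
  \<open>L = 0\<close> every factor is \<open>1\<close>, since division by zero gives zero.
\<close>
lemma abs_coeff_ratio_le_1: "\<bar>coeff_ratio L k\<bar> \<le> 1"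
proof (cases "L < k \<and> 0 < L")
  case False
  have "\<bar>1 - real (i * (i + 1)) / legendre_eigenvalue L\<bar> \<le> 1" if "i < k" for i
  proof (cases "L = 0")
    case False
    then have "i * (i + 1) \<le> L * (L + 1)"
      using \<open>\<not> (L < k \<and> 0 < L)\<close> that by (intro mult_mono) auto
    then have "real (i * (i + 1)) \<le> legendre_eigenvalue L"
      by (simp only: legendre_eigenvalue_def of_nat_le_iff)
    then have "real (i * (i + 1)) / legendre_eigenvalue L \<le> 1"
      using legendre_eigenvalue_pos[of L] False by (simp only: divide_le_eq_1_pos)
    moreover have "0 \<le> real (i * (i + 1)) / legendre_eigenvalue L"
      using legendre_eigenvalue_pos[of L] False by (intro divide_nonneg_pos) auto
    ultimately show ?thesis by linarith
  qed (simp add: legendre_eigenvalue_def)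
  then show ?thesis
    unfolding coeff_ratio_def abs_prod by (intro prod_le_1) auto
qed (simp add: coeff_ratio_zero)

lemma coeff_ratio_tendsto_1: "(\<lambda>L. coeff_ratio L k) \<longlonglongrightarrow> 1"
proof -
  have "filterlim legendre_eigenvalue at_top sequentially"
  proof (rule filterlim_at_top_mono[OF filterlim_real_sequentially always_eventually])
    show "\<forall>L. real L \<le> legendre_eigenvalue L"
      unfolding legendre_eigenvalue_def of_nat_le_iff by simp
  qed
  then have "(\<lambda>L. real (i * (i + 1)) / legendre_eigenvalue L) \<longlonglongrightarrow> 0" for i
    by (intro tendsto_divide_0[OF tendsto_const] filterlim_at_top_imp_at_infinity)
  then have "(\<lambda>L. coeff_ratio L k) \<longlonglongrightarrow> (\<Prod>i<k. 1 - 0)"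
    unfolding coeff_ratio_def by (intro tendsto_intros)
  then show ?thesis by simp
qed

text \<open>The factors split as \<open>L (L + 1) - i (i + 1) = (L - i) (L + i + 1)\<close>, so the product telescopes to factorials.\<close>
lemma coeff_ratio_eq:
  assumes "0 < L" "k \<le> L"
  shows "coeff_ratio L k = fact (L + k) / (fact (L - k) * legendre_eigenvalue L ^ k)"
  using assms(2)
proof (induction k)
  case (Suc k)
  define lam where "lam = legendre_eigenvalue L"
  have lam: "lam \<noteq> 0" using legendre_eigenvalue_pos[OF assms(1)] by (simp add: lam_def)
  have f: "(fact (L - k) :: real) = real (L - k) * fact (L - Suc k)"
    using Suc.prems by (metis Suc_diff_Suc Suc_le_lessD fact_Suc of_nat_fact of_nat_mult)
  have "coeff_ratio L (Suc k) = coeff_ratio L k * ((lam - real (k * (k + 1))) / lam)"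
    using lam by (simp add: coeff_ratio_def lam_def diff_divide_distrib)
  also have "lam - real (k * (k + 1)) = real (L - k) * real (L + Suc k)"
    using Suc.prems by (simp add: lam_def legendre_eigenvalue_def of_nat_diff algebra_simps)
  also have "coeff_ratio L k = fact (L + k) / (fact (L - k) * lam ^ k)"
    using Suc by (simp add: lam_def)
  finally show ?case
    by (simp add: f mult_ac flip: lam_def) (use Suc.prems in \<open>simp add: mult_ac\<close>)
qed (simp add: coeff_ratio_def)

definition rescaled_legendre :: "nat \<Rightarrow> real \<Rightarrow> real" where
  "rescaled_legendre L s = poly (legendre L) (1 - 2 * s / legendre_eigenvalue L)"

lemma rescaled_legendre_series:
  assumes "0 < L"
  shows "(\<lambda>k. coeff_ratio L k * ((-1) ^ k / (fact k * fact k) * s ^ k)) sums rescaled_legendre L s"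
proof -
  define lam where "lam = legendre_eigenvalue L"
  have "rescaled_legendre L s = (\<Sum>k\<le>L. coeff_ratio L k * ((-1) ^ k / (fact k * fact k) * s ^ k))"
  proof -
    have "(- 2 * s / lam / 2) ^ k = (-1) ^ k * s ^ k / lam ^ k" for k
      using power_minus[of "s / lam" k] by (simp add: power_divide)
    then show ?thesis
      using poly_legendre_around_1[of L "- 2 * s / lam"] assms
      by (auto simp: rescaled_legendre_def coeff_ratio_eq power2_eq_square mult_ac
          simp flip: lam_def intro!: sum.cong)
  qed
  moreover have "(\<lambda>k. coeff_ratio L k * ((-1) ^ k / (fact k * fact k) * s ^ k)) sums
     (\<Sum>k\<le>L. coeff_ratio L k * ((-1) ^ k / (fact k * fact k) * s ^ k))"
    by (rule sums_finite) (use assms coeff_ratio_zero in auto)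
  ultimately show ?thesis by simp
qed

lemma coeff_ratio_term_le:
  assumes "\<bar>s\<bar> \<le> R"
  shows "\<bar>coeff_ratio L k * ((-1) ^ k / (fact k * fact k) * s ^ k)\<bar> \<le> R ^ k / fact k"
proof -
  have "\<bar>coeff_ratio L k * ((-1) ^ k / (fact k * fact k) * s ^ k)\<bar>
      \<le> 1 * (\<bar>s\<bar> ^ k / fact k)"
    unfolding abs_mult[of "coeff_ratio L k"]
    using bessel_clifford_term_le[of k 0 s] abs_coeff_ratio_le_1 by (intro mult_mono) auto
  also have "\<dots> \<le> R ^ k / fact k"
    using assms by (auto intro!: divide_right_mono power_mono)
  finally show ?thesis .
qed

lemma rescaled_legendre_bound:
  assumes "0 < L" "\<bar>s\<bar> \<le> R"
  shows "\<bar>rescaled_legendre L s\<bar> \<le> exp R"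
proof -
  have "(\<lambda>k. R ^ k / fact k) sums exp R"
    using exp_converges[of R] by (simp add: field_simps)
  note exp = this
  note series = rescaled_legendre_series[OF assms(1), of s]
  have "rescaled_legendre L s \<le> exp R"
    by (rule sums_le[OF _ series exp]) (use coeff_ratio_term_le[OF assms(2), of L] in \<open>simp only: abs_le_iff\<close>)
  moreover have "- rescaled_legendre L s \<le> exp R"
    by (rule sums_le[OF _ sums_minus[OF series] exp])
       (use coeff_ratio_term_le[OF assms(2), of L] in \<open>simp only: abs_le_iff\<close>)
  ultimately show ?thesis by linarith
qed

text \<open>
  The arguments may vary with \<open>L\<close> within a bounded set, which replaces locally uniform convergence: the
  bound \<open>2 R\<^sup>k / k!\<close> on the terms of the difference does not depend on them, and Tannery's theorem applies.
\<close>
lemma rescaled_legendre_tendsto: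
  assumes "\<And>L. \<bar>x L\<bar> \<le> R"
  shows "(\<lambda>L. rescaled_legendre L (x L) - bessel_clifford 0 (x L)) \<longlonglongrightarrow> 0"
proof -
  define a where "a = (\<lambda>k L. (coeff_ratio L k - 1) * ((-1) ^ k / (fact k * fact k) * x L ^ k))"
  have le: "\<bar>a k L\<bar> \<le> 2 * (R ^ k / fact k)" for k L
  proof -
    have "\<bar>a k L\<bar> \<le> 2 * (\<bar>x L\<bar> ^ k / fact k)"
      unfolding a_def abs_mult[of "coeff_ratio L k - 1"]
      using bessel_clifford_term_le[of k 0 "x L"] abs_coeff_ratio_le_1[of L k]
      by (intro mult_mono) auto
    also have "\<dots> \<le> 2 * (R ^ k / fact k)"
      using assms by (auto intro!: divide_right_mono power_mono mult_left_mono)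
    finally show ?thesis .
  qed
  have "(\<lambda>L. a k L) \<longlonglongrightarrow> 0" for k
  proof (rule Lim_null_comparison[OF always_eventually])
    show "\<forall>L. norm (a k L) \<le> \<bar>coeff_ratio L k - 1\<bar> * (R ^ k / fact k)"
    proof
      fix L
      have "\<bar>x L\<bar> ^ k / fact k \<le> R ^ k / fact k"
        using assms by (auto intro!: divide_right_mono power_mono)
      with bessel_clifford_term_le[of k 0 "x L"] 
      show "norm (a k L) \<le> \<bar>coeff_ratio L k - 1\<bar> * (R ^ k / fact k)"
        unfolding a_def real_norm_def abs_mult[of "coeff_ratio L k - 1"]
        by (intro mult_left_mono) auto
    qed
    have "(\<lambda>L. \<bar>coeff_ratio L k - 1\<bar> * (R ^ k / fact k)) \<longlonglongrightarrow> \<bar>1 - 1\<bar> * (R ^ k / fact k)"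
      by (intro tendsto_intros coeff_ratio_tendsto_1)
    then show "(\<lambda>L. \<bar>coeff_ratio L k - 1\<bar> * (R ^ k / fact k)) \<longlonglongrightarrow> 0" by simp
  qed
  then have "(\<lambda>L. \<Sum>k. a k L) \<longlonglongrightarrow> (\<Sum>k. 0)"
    using tannerys_theorem[of a "\<lambda>_. 0" sequentially "\<lambda>k. 2 * (R ^ k / fact k)"] le
      summable_mult[OF summable_power_divide_fact[of R], of 2]
    by (auto simp: case_prod_unfold)
  moreover have "\<forall>\<^sub>F L in sequentially. (\<Sum>k. a k L) = rescaled_legendre L (x L) - bessel_clifford 0 (x L)"
    using eventually_gt_at_top[of 0]
  proof eventually_elim
    case (elim L)
    have "(\<lambda>k. (-1) ^ k / (fact k * fact k) * x L ^ k) sums bessel_clifford 0 (x L)"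
      using summable_sums[OF summable_bessel_clifford[of 0 "x L"]] by (simp add: bessel_clifford_def)
    from sums_diff[OF rescaled_legendre_series[OF elim, of "x L"] this]
    have "(\<lambda>k. a k L) sums (rescaled_legendre L (x L) - bessel_clifford 0 (x L))"
      by (simp only: a_def left_diff_distrib mult_1)
    then show ?case by (rule sums_unique[symmetric])
  qed
  ultimately show ?thesis
    by (simp add: tendsto_cong)
qed

text \<open>The Taylor coefficients at \<open>1\<close> up to the degree are positive, so every zero lies to the left of \<open>1\<close>.\<close>
lemma poly_legendre_pos:
  assumes "1 \<le> x"
  shows "0 < poly (legendre n) x"
proof -
  have "0 < (\<Sum>k\<le>n. fact (n + k) / (fact (n - k) * (fact k)\<^sup>2) * ((x - 1) / 2) ^ k)"
    using assms by (intro sum_pos2[of _ 0]) auto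
  then show ?thesis using poly_legendre_around_1[of n "x - 1"] by simp
qed

definition rescaled_zero :: "nat \<Rightarrow> real" where
  "rescaled_zero L = legendre_eigenvalue L / 2 * (1 - legendre_largest_zero L)"

lemma finite_legendre_zeros: "finite {x. poly (legendre L) x = 0}"
  using poly_legendre_pos[of 1 L] by (intro poly_roots_finite) auto

text \<open>
  A sign change of the rescaled polynomial between \<open>0\<close>, where it is \<open>1\<close>, and \<open>s\<close> produces a zero of \<open>P\<^sub>L\<close>
  close to \<open>1\<close>, which the largest zero can only exceed. This also ensures that there is a zero at all.
\<close>
lemma rescaled_zero:
  assumes "0 < L" "0 < s" "rescaled_legendre L s < 0"
  shows "0 < rescaled_zero L" "rescaled_zero L < s" "rescaled_legendre L (rescaled_zero L) = 0"
proof -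
  define lam where "lam = legendre_eigenvalue L"
  have lam: "0 < lam" using legendre_eigenvalue_pos[OF assms(1)] by (simp add: lam_def)
  have "\<exists>r>0. r < s \<and> rescaled_legendre L r = 0"
  proof -
    have "\<exists>r\<ge>0. r \<le> s \<and> rescaled_legendre L r = 0"
      using assms legendre_at_1[of L]
      by (intro IVT2') (auto simp: rescaled_legendre_def intro!: continuous_intros)
    moreover have "rescaled_legendre L 0 = 1"
      by (simp add: rescaled_legendre_def legendre_at_1)
    ultimately show ?thesis
      using assms by (metis less_eq_real_def less_irrefl zero_neq_one)
  qed
  then obtain r where r: "0 < r" "r < s" "rescaled_legendre L r = 0" by blast
  define t where "t = legendre_largest_zero L"
  have r': "poly (legendre L) (1 - 2 * r / lam) = 0"
    using r by (simp add: rescaled_legendre_def lam_def)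
  have t: "poly (legendre L) t = 0"
    using Max_in[OF finite_legendre_zeros[of L]] r' by (auto simp: t_def legendre_largest_zero_def)
  have "1 - 2 * r / lam \<le> t"
    using Max_ge[OF finite_legendre_zeros[of L]] r' by (auto simp: t_def legendre_largest_zero_def)
  then have "lam / 2 * (1 - t) \<le> r"
    using lam by (simp add: field_simps)
  then show "rescaled_zero L < s"
    using r by (simp add: rescaled_zero_def lam_def t_def)
  have "t < 1" using poly_legendre_pos[of t L] t by force
  then show "0 < rescaled_zero L"
    using lam by (simp add: rescaled_zero_def lam_def t_def)
  show "rescaled_legendre L (rescaled_zero L) = 0"
    using t lam by (simp add: rescaled_zero_def rescaled_legendre_def flip: lam_def t_def)
qed

text \<open>
  The point \<open>3 / 2\<close> is a convenient one slightly beyond the zero \<open>1.4458\<close> of \<open>C\<^sub>0\<close>, where \<open>C\<^sub>0\<close> is negative.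
\<close>
lemma rescaled_legendre_neg:
  "\<forall>\<^sub>F L in sequentially. 0 < L \<and> rescaled_legendre L (3 / 2) < 0"
proof -
  have "(\<lambda>L. rescaled_legendre L (3 / 2) - bessel_clifford 0 (3 / 2)) \<longlonglongrightarrow> 0"
    by (rule rescaled_legendre_tendsto[of "\<lambda>_. 3 / 2" "3 / 2"]) simp
  from tendsto_add[OF this tendsto_const[of "bessel_clifford 0 (3 / 2)"]]
  have "(\<lambda>L. rescaled_legendre L (3 / 2)) \<longlonglongrightarrow> bessel_clifford 0 (3 / 2)" by simp
  moreover have "bessel_clifford 0 (3 / 2) < 0"
    using bessel_clifford_strict_antimono[of clifford_zero "3 / 2" 0] clifford_zero clifford_zero_pos
      clifford_zero_less by simp
  ultimately show ?thesis
    using eventually_gt_at_top[of 0] by (intro eventually_conj) (auto dest: order_tendstoD(2))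
qed

section \<open>Convergence of the zeros and of the integrals\<close>

text \<open>
  On \<open>[0, 3 / 2]\<close> the slope is \<open>- C\<^sub>1 z \<le> - (1 - z / 2) \<le> - 1 / 4\<close>. This quantifies that the zero of \<open>C\<^sub>0\<close> is
  simple.
\<close>
lemma bessel_clifford_0_drop:
  assumes "0 \<le> x" "x \<le> y" "y \<le> 3 / 2"
  shows "y - x \<le> 4 * (bessel_clifford 0 x - bessel_clifford 0 y)"
proof -
  have "bessel_clifford 0 y + y / 4 \<le> bessel_clifford 0 x + x / 4"
  proof (rule DERIV_nonpos_imp_nonincreasing[OF assms(2)])
    fix z assume z: "x \<le> z" "z \<le> y"
    have "((\<lambda>z. bessel_clifford 0 z + z / 4) has_real_derivative - bessel_clifford 1 z + 1 / 4) (at z)"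
      using DERIV_add[OF bessel_clifford_deriv[of 0 z] DERIV_cdivide[OF DERIV_ident, of 4]] by simp
    moreover have "1 - z / 2 \<le> bessel_clifford 1 z"
      using bessel_clifford_pos(1)[of z 1] z assms by simp
    then have "- bessel_clifford 1 z + 1 / 4 \<le> 0"
      using z assms by simp
    ultimately show "\<exists>d. ((\<lambda>z. bessel_clifford 0 z + z / 4) has_real_derivative d) (at z) \<and> d \<le> 0"
      by blast
  qed
  then show ?thesis by simp
qed

lemma clifford_zero_separation:
  assumes "0 \<le> s" "s \<le> 3 / 2"
  shows "\<bar>s - clifford_zero\<bar> \<le> 4 * \<bar>bessel_clifford 0 s\<bar>"
  using bessel_clifford_0_drop[of s clifford_zero] bessel_clifford_0_drop[of clifford_zero s]
    assms clifford_zero(3) clifford_zero_pos clifford_zero_less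
  by (cases "s \<le> clifford_zero") auto

lemma rescaled_zero_tendsto: "rescaled_zero \<longlonglongrightarrow> clifford_zero"
proof -
  \<comment> \<open>The default value 0 keeps the sequence bounded at every index.\<close>
  define x where
    "x = (\<lambda>L. if 0 < L \<and> rescaled_legendre L (3 / 2) < 0 then rescaled_zero L else 0)"
  have "\<bar>x L\<bar> \<le> 3 / 2" for L
    using rescaled_zero(1,2)[of L "3 / 2"] by (auto simp: x_def)
  then have "(\<lambda>L. rescaled_legendre L (x L) - bessel_clifford 0 (x L)) \<longlonglongrightarrow> 0"
    by (rule rescaled_legendre_tendsto)
  from tendsto_mult_right[OF tendsto_rabs[OF this], of 4]
  have lim: "(\<lambda>L. 4 * \<bar>rescaled_legendre L (x L) - bessel_clifford 0 (x L)\<bar>) \<longlonglongrightarrow> 0"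
    by (simp add: mult.commute)
  have "(\<lambda>L. rescaled_zero L - clifford_zero) \<longlonglongrightarrow> 0"
  proof (rule Lim_null_comparison[OF _ lim])
    show "\<forall>\<^sub>F L in sequentially. norm (rescaled_zero L - clifford_zero)
        \<le> 4 * \<bar>rescaled_legendre L (x L) - bessel_clifford 0 (x L)\<bar>"
      using rescaled_legendre_neg
    proof eventually_elim
      case (elim L)
      have "x L = rescaled_zero L" using elim by (simp add: x_def)
      then show ?case
        using rescaled_zero[of L "3 / 2"] clifford_zero_separation[of "rescaled_zero L"] elim by simp
    qed
  qed
  then show ?thesis by (rule LIM_zero_cancel)
qed

text \<open>
  Substituting \<open>t = 1 - d v\<close> with \<open>d = 1 - t\<^sub>L\<^sub>,\<^sub>L\<close> makes the interval of integration independent of \<open>L\<close> and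
  cancels the factor \<open>d\<close> of \<open>B L\<close>.
\<close>
lemma B_eq:
  assumes "0 < L" "0 < rescaled_zero L"
  shows "B L = inverse (integral {0..1} (\<lambda>v. (rescaled_legendre L (rescaled_zero L * v))\<^sup>2))"
proof -
  define t where "t = legendre_largest_zero L"
  define d where "d = 1 - t"
  have lam: "0 < legendre_eigenvalue L" using legendre_eigenvalue_pos[OF assms(1)] .
  have d: "0 < d" using assms(2) lam by (simp add: rescaled_zero_def d_def t_def zero_less_mult_iff)
  define f where "f = (\<lambda>x. (poly (legendre L) x)\<^sup>2)"
  have "f integrable_on cbox t 1"
    unfolding f_def cbox_interval by (intro integrable_continuous_real continuous_intros)
  then have "(f has_integral integral {t..1} f) (cbox t 1)" by (simp add: integrable_integral)
  from has_integral_affinity[OF this, of "- d" 1]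
  have "((\<lambda>v. f (1 - d * v)) has_integral integral {t..1} f / d) ((\<lambda>x. (1 - x) / d) ` {t..1})"
    using d by (simp add: field_simps)
  moreover have "(\<lambda>x. (1 - x) / d) ` {t..1} = {0..1}"
  proof
    show "{0..1} \<subseteq> (\<lambda>x. (1 - x) / d) ` {t..1}"
    proof
      fix v :: real assume "v \<in> {0..1}"
      then have "0 \<le> d * v" "d * v \<le> d"
        using d mult_left_le[of v d] by auto
      then have "1 - d * v \<in> {t..1}"
        unfolding atLeastAtMost_iff using d_def by linarith
      moreover have "v = (1 - (1 - d * v)) / d" using d by simp
      ultimately show "v \<in> (\<lambda>x. (1 - x) / d) ` {t..1}" by blast
    qed
    show "(\<lambda>x. (1 - x) / d) ` {t..1} \<subseteq> {0..1}"
      using d by (auto simp: d_def divide_le_eq)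
  qed
  ultimately have "integral {0..1} (\<lambda>v. f (1 - d * v)) = integral {t..1} f / d"
    by (simp add: integral_unique)
  moreover have "f (1 - d * v) = (rescaled_legendre L (rescaled_zero L * v))\<^sup>2" for v
    using lam by (simp add: f_def rescaled_legendre_def rescaled_zero_def d_def t_def)
  ultimately show ?thesis
    using d by (simp add: B_def f_def d_def t_def divide_inverse)
qed

text \<open>
  Dominated convergence with a constant bound: the arguments stay in \<open>[0, 3 / 2]\<close> once the zero does. The
  index is shifted by \<open>N\<close> so that this holds for all members of the sequence.
\<close>
lemma integral_rescaled_tendsto:
  "(\<lambda>L. integral {0..1} (\<lambda>v. (rescaled_legendre L (rescaled_zero L * v))\<^sup>2))
     \<longlonglongrightarrow> clifford_zero * (bessel_clifford 1 clifford_zero)\<^sup>2"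
proof -
  obtain N where N: "\<And>L. N \<le> L \<Longrightarrow> 0 < L \<and> rescaled_legendre L (3 / 2) < 0"
    using rescaled_legendre_neg by (auto simp: eventually_sequentially)
  define s where "s = (\<lambda>L. rescaled_zero (L + N))"
  have s: "0 < s L" "s L < 3 / 2" for L
    using rescaled_zero[of "L + N" "3 / 2"] N[of "L + N"] by (simp_all add: s_def)
  have s_lim: "s \<longlonglongrightarrow> clifford_zero"
    unfolding s_def by (rule LIMSEQ_ignore_initial_segment[OF rescaled_zero_tendsto])
  have sv: "\<bar>s L * v\<bar> \<le> 3 / 2" if "v \<in> {0..1}" for L v
    using s[of L] that mult_mono[of "s L" "3 / 2" v 1] by simp
  have "(\<lambda>L. integral {0..1} (\<lambda>v. (rescaled_legendre (L + N) (s L * v))\<^sup>2))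
      \<longlonglongrightarrow> integral {0..1} (\<lambda>v. (bessel_clifford 0 (clifford_zero * v))\<^sup>2)"
  proof (rule dominated_convergence(2))
    show "(\<lambda>v. (rescaled_legendre (L + N) (s L * v))\<^sup>2) integrable_on {0..1}" for L
      unfolding rescaled_legendre_def
      using legendre_eigenvalue_pos[of "L + N"] N[of "L + N"]
      by (intro integrable_continuous_real continuous_intros) auto
    show "(\<lambda>v. (exp (3 / 2))\<^sup>2) integrable_on {0..1 :: real}"
      by (intro integrable_continuous_real continuous_intros)
    show "norm ((rescaled_legendre (L + N) (s L * v))\<^sup>2) \<le> (exp (3 / 2))\<^sup>2" if "v \<in> {0..1}" for L v
      using rescaled_legendre_bound[OF _ sv[OF that], of "L + N" L] N[of "L + N"]
      by (simp only: real_norm_def abs_power2 power2_abs[symmetric, of "rescaled_legendre _ _"])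
         (intro power_mono; simp)
    show "(\<lambda>L. (rescaled_legendre (L + N) (s L * v))\<^sup>2) \<longlonglongrightarrow> (bessel_clifford 0 (clifford_zero * v))\<^sup>2"
      if "v \<in> {0..1}" for v
    proof -
      \<comment> \<open>Truncated subtraction: the first \<open>N\<close> members repeat \<open>s 0\<close> and keep the sequence bounded.\<close>
      define x where "x = (\<lambda>L. s (L - N) * v)"
      have "(\<lambda>L. rescaled_legendre L (x L) - bessel_clifford 0 (x L)) \<longlonglongrightarrow> 0"
        by (rule rescaled_legendre_tendsto[of _ "3 / 2"]) (simp only: x_def sv[OF that])
      from LIMSEQ_ignore_initial_segment[OF this, of N]
      have "(\<lambda>L. rescaled_legendre (L + N) (s L * v) - bessel_clifford 0 (s L * v)) \<longlonglongrightarrow> 0"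
        by (simp add: x_def)
      moreover have "(\<lambda>L. bessel_clifford 0 (s L * v)) \<longlonglongrightarrow> bessel_clifford 0 (clifford_zero * v)"
        using DERIV_isCont[OF bessel_clifford_deriv]
        by (intro isCont_tendsto_compose[of _ "bessel_clifford 0"] tendsto_mult_right s_lim) auto
      ultimately have "(\<lambda>L. rescaled_legendre (L + N) (s L * v)) \<longlonglongrightarrow> bessel_clifford 0 (clifford_zero * v)"
        by (rule Lim_transform[rotated])
      then show ?thesis by (intro tendsto_power)
    qed
  qed
  also have "integral {0..1} (\<lambda>v. (bessel_clifford 0 (clifford_zero * v))\<^sup>2)
      = clifford_zero * (bessel_clifford 1 clifford_zero)\<^sup>2"
    by (rule integral_unique[OF integral_bessel_clifford_sq[OF clifford_zero_pos clifford_zero(3)]])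
  finally show ?thesis
    unfolding s_def by (rule LIMSEQ_offset)
qed

theorem lemma3p4:
  shows "(B \<longlonglongrightarrow> (bessel_J 1 bessel_j01) powi (-2)) \<and>
         \<bar>(bessel_J 1 bessel_j01) powi (-2) - 3.71038068570948\<bar> \<le> 0.5 * 10 powi (-14)"
proof
  have J: "(bessel_J 1 bessel_j01) powi (-2) = inverse ((bessel_J 1 bessel_j01)\<^sup>2)"
    by (simp add: power_int_minus)
  have "0 < bessel_clifford 1 clifford_zero"
    using clifford_zero_pos clifford_zero_less by (intro bessel_clifford_pos(2)) auto
  then have "clifford_zero * (bessel_clifford 1 clifford_zero)\<^sup>2 \<noteq> 0"
    using clifford_zero_pos by simp
  from tendsto_inverse[OF integral_rescaled_tendsto this]
  have "(\<lambda>L. inverse (integral {0..1} (\<lambda>v. (rescaled_legendre L (rescaled_zero L * v))\<^sup>2)))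
      \<longlonglongrightarrow> (bessel_J 1 bessel_j01) powi (-2)"
    unfolding J bessel_J1_at_zero .
  moreover have "\<forall>\<^sub>F L in sequentially.
      inverse (integral {0..1} (\<lambda>v. (rescaled_legendre L (rescaled_zero L * v))\<^sup>2)) = B L"
    using rescaled_legendre_neg
    by eventually_elim (use B_eq rescaled_zero(1)[of _ "3 / 2"] in auto)
  ultimately show "B \<longlonglongrightarrow> (bessel_J 1 bessel_j01) powi (-2)"
    by (rule Lim_transform_eventually)
  have "(0.5 :: real) * 10 powi (-14) = 5 / 10 ^ 15"
    by (simp add: power_int_minus)
  then show "\<bar>(bessel_J 1 bessel_j01) powi (-2) - 3.71038068570948\<bar> \<le> 0.5 * 10 powi (-14)"
    using bessel_J1_at_zero_value by (simp only: J)
qed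

end
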